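(* Let $(\mathcal{E},\cdot)$ be a Leibniz algebra over a field $\mathbb{K}$ of characteristic $0$, let $\mathcal{M}$ be a two-sided ideal of $\mathcal{E}$ satisfying $\mathcal{J}\subseteq\mathcal{M}\subseteq\ker(\lambda)$, let $\mathfrak{h}=\mathcal{E}/\mathcal{M}$, and let $q:\mathcal{E}\to\mathfrak{h}$ be the natural projection. Then $(\mathfrak{h}\ltimes\mathcal{E},\mathfrak{h},q)$ is an enveloping Lie algebra for $(\mathcal{E},\cdot)$.
   Context: An algebra $(\mathcal{E},\cdot)$ is a $\mathbb{K}$-vector space with a (not necessarily associative) bilinear operation. It is a (left) Leibniz algebra if $x\cdot(y\cdot z)=(x\cdot y)\cdot z+y\cdot(x\cdot z)$ for all $x,y,z\in\mathcal{E}$. For $x\in\mathcal{E}$, $\lambda(x):\mathcal{E}\to\mathcal{E}$ is left multiplication, $\lambda(x)y=x\cdot y$; in a Leibniz algebra $\lambda(x)\in\mathrm{Der}(\mathcal{E})$, the Lie algebra of derivations of $(\mathcal{E},\cdot)$. $\mathcal{J}$ is the two-sided ideal of $(\mathcal{E},\cdot)$ generated by all squares $x\cdot x$, $x\in\mathcal{E}$. For an ideal $\mathcal{M}$ with $\mathcal{J}\subseteq\mathcal{M}\subseteq\ker(\lambda)$, the quotient $\mathfrak{h}=\mathcal{E}/\mathcal{M}$ is a Lie algebra with bracket $[q(x),q(y)]=q(x\cdot y)$, and it acts on $\mathcal{E}$ by derivations via $q(x)\,y=x\cdot y$ (the map $\overline{\lambda}:\mathfrak{h}\to\mathrm{Der}(\mathcal{E})$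 induced by $\lambda$). Enveloping Lie algebra: let $\mathfrak{h}$ be a Lie algebra with a derivation action on $\mathcal{E}$, i.e. a Lie algebra homomorphism $\mathfrak{h}\to\mathrm{Der}(\mathcal{E})$, written $(\xi,x)\mapsto\xi x$, and let $f:\mathcal{E}\to\mathfrak{h}$ be a linear map such that $[\xi,f(x)]=f(\xi x)$ and $f(x)y=x\cdot y$ for all $\xi\in\mathfrak{h}$, $x,y\in\mathcal{E}$. Let $\mathfrak{g}=\mathfrak{h}\ltimes\mathcal{E}$ be the semidirect product Lie algebra, with $\mathcal{E}$ regarded as a Lie algebra with zero bracket, so $[(\xi,x),(\eta,y)]=([\xi,\eta],\xi y-\eta x)$. Then the triple $(\mathfrak{g},\mathfrak{h},f)$ is called an enveloping Lie algebra of $(\mathcal{E},\cdot)$. *)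

theory Defs
  imports "HOL-Algebra.Module" "HOL-Algebra.QuotRing"
begin

text \<open>
  A not necessarily associative algebra over a field \<open>K\<close> is carried by the HOL-Algebra record
  \<^type>\<open>module_ext\<close>: the field \<^const>\<open>mult\<close> is the bilinear product (for a Lie algebra, the
  bracket).  The field \<^const>\<open>one\<close> of that record is never used and is left unspecified
  in the algebras constructed below.
\<close>

locale char_0_field = field K for K (structure) +
  assumes char_0: "0 < (n::nat) \<Longrightarrow> [n] \<cdot> \<one> \<noteq> \<zero>"

locale nonassoc_algebra = K?: field K + E?: module K E for K (structure) and E (structure) +
  assumes prod_closed:
      "\<lbrakk>x \<in> carrier E; y \<in> carrier E\<rbrakk> \<Longrightarrow> x \<otimes>\<^bsub>E\<^esub> y \<in> carrier E"
    and prod_add_left: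
      "\<lbrakk>x \<in> carrier E; y \<in> carrier E; z \<in> carrier E\<rbrakk>
        \<Longrightarrow> (x \<oplus>\<^bsub>E\<^esub> y) \<otimes>\<^bsub>E\<^esub> z = (x \<otimes>\<^bsub>E\<^esub> z) \<oplus>\<^bsub>E\<^esub> (y \<otimes>\<^bsub>E\<^esub> z)"
    and prod_add_right:
      "\<lbrakk>x \<in> carrier E; y \<in> carrier E; z \<in> carrier E\<rbrakk>
        \<Longrightarrow> x \<otimes>\<^bsub>E\<^esub> (y \<oplus>\<^bsub>E\<^esub> z) = (x \<otimes>\<^bsub>E\<^esub> y) \<oplus>\<^bsub>E\<^esub> (x \<otimes>\<^bsub>E\<^esub> z)"
    and prod_smult_left:
      "\<lbrakk>a \<in> carrier K; x \<in> carrier E; y \<in> carrier E\<rbrakk>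
        \<Longrightarrow> (a \<odot>\<^bsub>E\<^esub> x) \<otimes>\<^bsub>E\<^esub> y = a \<odot>\<^bsub>E\<^esub> (x \<otimes>\<^bsub>E\<^esub> y)"
    and prod_smult_right:
      "\<lbrakk>a \<in> carrier K; x \<in> carrier E; y \<in> carrier E\<rbrakk>
        \<Longrightarrow> x \<otimes>\<^bsub>E\<^esub> (a \<odot>\<^bsub>E\<^esub> y) = a \<odot>\<^bsub>E\<^esub> (x \<otimes>\<^bsub>E\<^esub> y)"

locale Leibniz_algebra = nonassoc_algebra +
  assumes leibniz:
      "\<lbrakk>x \<in> carrier E; y \<in> carrier E; z \<in> carrier E\<rbrakk>
        \<Longrightarrow> x \<otimes>\<^bsub>E\<^esub> (y \<otimes>\<^bsub>E\<^esub> z) = ((x \<otimes>\<^bsub>E\<^esub> y) \<otimes>\<^bsub>E\<^esub> z) \<oplus>\<^bsub>E\<^esub> (y \<otimes>\<^bsub>E\<^esub> (x \<otimes>\<^bsub>E\<^esub> z))"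

locale Lie_algebra = nonassoc_algebra K L for K (structure) and L (structure) +
  assumes bracket_self: "x \<in> carrier L \<Longrightarrow> x \<otimes>\<^bsub>L\<^esub> x = \<zero>\<^bsub>L\<^esub>"
    and jacobi:
      "\<lbrakk>x \<in> carrier L; y \<in> carrier L; z \<in> carrier L\<rbrakk>
        \<Longrightarrow> (x \<otimes>\<^bsub>L\<^esub> (y \<otimes>\<^bsub>L\<^esub> z)) \<oplus>\<^bsub>L\<^esub> (y \<otimes>\<^bsub>L\<^esub> (z \<otimes>\<^bsub>L\<^esub> x)) \<oplus>\<^bsub>L\<^esub> (z \<otimes>\<^bsub>L\<^esub> (x \<otimes>\<^bsub>L\<^esub> y)) = \<zero>\<^bsub>L\<^esub>"

definition linear_maps ::
    "('k, 'n) ring_scheme \<Rightarrow> ('k, 'v, 'a) module_scheme \<Rightarrow> ('k, 'w, 'b) module_scheme \<Rightarrow> ('v \<Rightarrow> 'w) set"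
  where "linear_maps K V W =
    {h \<in> carrier V \<rightarrow> carrier W.
      (\<forall>x\<in>carrier V. \<forall>y\<in>carrier V. h (x \<oplus>\<^bsub>V\<^esub> y) = h x \<oplus>\<^bsub>W\<^esub> h y) \<and>
      (\<forall>a\<in>carrier K. \<forall>x\<in>carrier V. h (a \<odot>\<^bsub>V\<^esub> x) = a \<odot>\<^bsub>W\<^esub> h x)}"

definition algebra_homs ::
    "('k, 'n) ring_scheme \<Rightarrow> ('k, 'v, 'a) module_scheme \<Rightarrow> ('k, 'w, 'b) module_scheme \<Rightarrow> ('v \<Rightarrow> 'w) set"
  where "algebra_homs K V W =
    {h \<in> linear_maps K V W.
      \<forall>x\<in>carrier V. \<forall>y\<in>carrier V. h (x \<otimes>\<^bsub>V\<^esub> y) = h x \<otimes>\<^bsub>W\<^esub> h y}"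

text \<open>
  Derivations are taken to be undefined outside the carrier of \<open>E\<close>, so that two derivations are
  equal as HOL functions exactly when they agree on \<open>E\<close>.
\<close>

definition derivations :: "('k, 'n) ring_scheme \<Rightarrow> ('k, 'e, 'a) module_scheme \<Rightarrow> ('e \<Rightarrow> 'e) set"
  where "derivations K E =
    {D \<in> linear_maps K E E \<inter> extensional (carrier E).
      \<forall>x\<in>carrier E. \<forall>y\<in>carrier E. D (x \<otimes>\<^bsub>E\<^esub> y) = (D x \<otimes>\<^bsub>E\<^esub> y) \<oplus>\<^bsub>E\<^esub> (x \<otimes>\<^bsub>E\<^esub> D y)}"

definition Der :: "('k, 'n) ring_scheme \<Rightarrow> ('k, 'e, 'a) module_scheme \<Rightarrow> ('k, 'e \<Rightarrow> 'e) module"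
  where "Der K E =
    \<lparr>carrier = derivations K E,
     mult = (\<lambda>D D'. \<lambda>x\<in>carrier E. D (D' x) \<ominus>\<^bsub>E\<^esub> D' (D x)),
     one = undefined,
     zero = (\<lambda>x\<in>carrier E. \<zero>\<^bsub>E\<^esub>),
     add = (\<lambda>D D'. \<lambda>x\<in>carrier E. D x \<oplus>\<^bsub>E\<^esub> D' x),
     smult = (\<lambda>a D. \<lambda>x\<in>carrier E. a \<odot>\<^bsub>E\<^esub> D x)\<rparr>"

definition left_mult :: "('k, 'e, 'a) module_scheme \<Rightarrow> 'e \<Rightarrow> 'e \<Rightarrow> 'e"
  where "left_mult E x = (\<lambda>y\<in>carrier E. x \<otimes>\<^bsub>E\<^esub> y)"

locale algebra_ideal = submodule M K E for M and K (structure) and E (structure) +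
  assumes ideal_left: "\<lbrakk>x \<in> carrier E; m \<in> M\<rbrakk> \<Longrightarrow> x \<otimes>\<^bsub>E\<^esub> m \<in> M"
    and ideal_right: "\<lbrakk>m \<in> M; x \<in> carrier E\<rbrakk> \<Longrightarrow> m \<otimes>\<^bsub>E\<^esub> x \<in> M"

definition squares_ideal :: "('k, 'n) ring_scheme \<Rightarrow> ('k, 'e, 'a) module_scheme \<Rightarrow> 'e set"
  where "squares_ideal K E =
    \<Inter>{I. algebra_ideal I K E \<and> (\<forall>x\<in>carrier E. x \<otimes>\<^bsub>E\<^esub> x \<in> I)}"

text \<open>
  The record \<^term>\<open>E Quot M\<close> already has the set of cosets \<open>M + x\<close> as carrier, with the sum and product
  induced from \<open>E\<close>; only the scalar multiplication has to be added.
\<close>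

definition quotient_algebra ::
    "('k, 'e, 'a) module_scheme \<Rightarrow> 'e set \<Rightarrow> ('k, 'e set) module"
  where "quotient_algebra E M =
    ring.extend (E Quot M) (module.fields (\<lambda>a X. \<Union>x\<in>X. M +>\<^bsub>E\<^esub> (a \<odot>\<^bsub>E\<^esub> x)))"

definition quotient_proj :: "('k, 'e, 'a) module_scheme \<Rightarrow> 'e set \<Rightarrow> 'e \<Rightarrow> 'e set"
  where "quotient_proj E M x = M +>\<^bsub>E\<^esub> x"

text \<open>
  The map on cosets induced by \<^const>\<open>left_mult\<close>; it is meaningful when \<^const>\<open>left_mult\<close> is constant
  on each coset, that is, when the ideal lies in its kernel.
\<close>

definition induced_action :: "('k, 'e, 'a) module_scheme \<Rightarrow> 'e set \<Rightarrow> 'e \<Rightarrow> 'e"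
  where "induced_action E X = the_elem (left_mult E ` X)"

definition semidirect_product ::
    "('k, 'h, 'a) module_scheme \<Rightarrow> ('h \<Rightarrow> 'e \<Rightarrow> 'e) \<Rightarrow> ('k, 'e, 'b) module_scheme \<Rightarrow> ('k, 'h \<times> 'e) module"
  where "semidirect_product H \<rho> E =
    \<lparr>carrier = carrier H \<times> carrier E,
     mult = (\<lambda>(\<xi>, x) (\<eta>, y). (\<xi> \<otimes>\<^bsub>H\<^esub> \<eta>, \<rho> \<xi> y \<ominus>\<^bsub>E\<^esub> \<rho> \<eta> x)),
     one = undefined,
     zero = (\<zero>\<^bsub>H\<^esub>, \<zero>\<^bsub>E\<^esub>),
     add = (\<lambda>(\<xi>, x) (\<eta>, y). (\<xi> \<oplus>\<^bsub>H\<^esub> \<eta>, x \<oplus>\<^bsub>E\<^esub> y)),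
     smult = (\<lambda>a (\<xi>, x). (a \<odot>\<^bsub>H\<^esub> \<xi>, a \<odot>\<^bsub>E\<^esub> x))\<rparr>"

text \<open>
  The triple \<open>(G, H, f)\<close> is an enveloping Lie algebra of \<open>E\<close>, where the derivation action of \<open>H\<close> on \<open>E\<close>,
  which is part of the given data, is recorded as the parameter \<open>\<rho>\<close>.
\<close>

locale enveloping_Lie_algebra =
  E?: Leibniz_algebra K E + H?: Lie_algebra K H + G?: Lie_algebra K G
  for K (structure) and E (structure) and \<rho> and G (structure) and H (structure) and f +
  assumes action: "\<rho> \<in> algebra_homs K H (Der K E)"
    and semidirect: "G = semidirect_product H \<rho> E"
    and f_linear: "f \<in> linear_maps K E H"
    and f_equivariant: "\<lbrakk>\<xi> \<in> carrier H; x \<in> carrier E\<rbrakk> \<Longrightarrow> \<xi> \<otimes>\<^bsub>H\<^esub> f x = f (\<rho> \<xi> x)"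
    and f_action: "\<lbrakk>x \<in> carrier E; y \<in> carrier E\<rbrakk> \<Longrightarrow> \<rho> (f x) y = x \<otimes>\<^bsub>E\<^esub> y"

end

theory Submission
  imports Defs
begin

text \<open>
  Write \<open>h\<close> for the quotient by \<open>M\<close> and \<open>q\<close> for the projection.  The two inclusions on \<open>M\<close> do
  separate jobs.  Since \<open>M\<close> contains the squares, the product of \<open>h\<close> is alternating, and an
  alternating product that inherits the Leibniz identity satisfies the Jacobi identity; so \<open>h\<close> is a
  Lie algebra (\<open>Leibniz_image_Lie_algebra\<close>).  Since left multiplication vanishes on \<open>M\<close>, it is
  constant on cosets, so the induced action is given by \<open>q(x) y = x \<cdot> y\<close> (\<open>induced_action_proj\<close>).

  The Leibniz identity, read in two ways, says that each left multiplication is a derivation and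
  that \<open>\<lambda>(x \<cdot> y) = [\<lambda>(x), \<lambda>(y)]\<close>, i.e. that \<open>\<lambda>\<close> is a homomorphism into the derivations
  (\<open>left_mult_hom\<close>).  The latter property descends to \<open>h\<close>.  In particular \<open>h\<close> is represented on
  the vector space underlying the algebra, and the semidirect product of a Lie algebra with any of
  its representations is a Lie algebra (\<open>semidirect_product_Lie_algebra\<close>).  Finally, with
  \<open>\<xi> = q(x)\<close>, the equivariance \<open>[\<xi>, q(y)] = q(\<xi> y)\<close> only says that \<open>q\<close> is multiplicative.
\<close>

section \<open>Homomorphic images of algebras\<close>

text \<open>
  The target \<open>Q\<close> is an arbitrary record here: every algebra axiom transfers along the surjection, so
  the axioms for cosets follow once the projection is known to respect the operations.  The zero of
  \<open>Q\<close> is a separate record field and has to be tied to \<open>q\<close> explicitly.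
\<close>

locale algebra_epimorphism = nonassoc_algebra K E for K (structure) and E (structure) +
  fixes Q :: "('k, 'q, 'c) module_scheme" and q
  assumes surj: "carrier Q = q ` carrier E"
    and zero: "\<zero>\<^bsub>Q\<^esub> = q \<zero>\<^bsub>E\<^esub>"
    and hom: "q \<in> algebra_homs K E Q"
begin

lemma map_closed: "x \<in> carrier E \<Longrightarrow> q x \<in> carrier Q"
  using surj by blast

lemma map_simps:
  assumes "x \<in> carrier E"
  shows "y \<in> carrier E \<Longrightarrow> q x \<oplus>\<^bsub>Q\<^esub> q y = q (x \<oplus>\<^bsub>E\<^esub> y)"
    and "y \<in> carrier E \<Longrightarrow> q x \<otimes>\<^bsub>Q\<^esub> q y = q (x \<otimes>\<^bsub>E\<^esub> y)"
    and "a \<in> carrier K \<Longrightarrow> a \<odot>\<^bsub>Q\<^esub> q x = q (a \<odot>\<^bsub>E\<^esub> x)"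
  using hom assms by (simp_all add: algebra_homs_def linear_maps_def)

lemma image_abelian_group: "abelian_group Q"
proof (rule abelian_groupI)
  fix X assume "X \<in> carrier Q"
  then obtain x where x: "x \<in> carrier E" "X = q x"
    using surj by blast
  then have "q (\<ominus>\<^bsub>E\<^esub> x) \<oplus>\<^bsub>Q\<^esub> X = \<zero>\<^bsub>Q\<^esub>"
    by (simp add: map_simps zero M.l_neg)
  then show "\<exists>Y\<in>carrier Q. Y \<oplus>\<^bsub>Q\<^esub> X = \<zero>\<^bsub>Q\<^esub>"
    using x map_closed by blast
qed (auto simp: surj zero map_simps M.a_ac)

lemma image_algebra: "nonassoc_algebra K Q"
proof (intro nonassoc_algebra.intro nonassoc_algebra_axioms.intro moduleI)
  show "field K" "cring K"
    by unfold_locales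
  show "abelian_group Q"
    by (rule image_abelian_group)
qed (auto simp: surj map_simps prod_closed prod_add_left prod_add_right prod_smult_left
      prod_smult_right smult_l_distr smult_r_distr smult_assoc1)

end

text \<open>
  Expanding the square of a sum shows that vanishing squares make the product of the image antisymmetric, and
  the Leibniz identity \<open>x(yz) = (xy)z + y(xz)\<close> then is the Jacobi identity, because
  \<open>y(zx) = -y(xz)\<close> and \<open>z(xy) = -(xy)z\<close>.
\<close>

lemma Leibniz_image_Lie_algebra:
  fixes K (structure) and E (structure) and Q (structure)
  assumes "Leibniz_algebra K E" and "algebra_epimorphism K E Q q"
    and squares: "\<And>x. x \<in> carrier E \<Longrightarrow> q (x \<otimes>\<^bsub>E\<^esub> x) = \<zero>\<^bsub>Q\<^esub>"
  shows "Lie_algebra K Q"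
proof -
  interpret E: Leibniz_algebra K E by fact
  interpret algebra_epimorphism K E Q q by fact
  interpret Q: nonassoc_algebra K Q by (rule image_algebra)
  have self: "X \<otimes>\<^bsub>Q\<^esub> X = \<zero>\<^bsub>Q\<^esub>" if "X \<in> carrier Q" for X
    using that squares by (auto simp: surj map_simps)
  have leib: "X \<otimes>\<^bsub>Q\<^esub> (Y \<otimes>\<^bsub>Q\<^esub> Z) = ((X \<otimes>\<^bsub>Q\<^esub> Y) \<otimes>\<^bsub>Q\<^esub> Z) \<oplus>\<^bsub>Q\<^esub> (Y \<otimes>\<^bsub>Q\<^esub> (X \<otimes>\<^bsub>Q\<^esub> Z))"
    if XYZ: "X \<in> carrier Q" "Y \<in> carrier Q" "Z \<in> carrier Q" for X Y Z
  proof -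
    obtain x y z where "x \<in> carrier E" "y \<in> carrier E" "z \<in> carrier E"
      and "X = q x" "Y = q y" "Z = q z"
      using XYZ unfolding surj by blast
    then show ?thesis
      by (simp add: map_simps E.prod_closed E.leibniz[of x y z])
  qed
  have anti: "X \<otimes>\<^bsub>Q\<^esub> Y \<oplus>\<^bsub>Q\<^esub> Y \<otimes>\<^bsub>Q\<^esub> X = \<zero>\<^bsub>Q\<^esub>" if "X \<in> carrier Q" "Y \<in> carrier Q" for X Y
    using self[of "X \<oplus>\<^bsub>Q\<^esub> Y"] self[of X] self[of Y] that
    by (simp add: Q.prod_add_left Q.prod_add_right Q.prod_closed Q.M.a_comm)
  show ?thesis
  proof (unfold_locales, goal_cases)
    case (1 X) then show ?case by (rule self)
  next
    case (2 X Y Z)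
    let ?A = "(X \<otimes>\<^bsub>Q\<^esub> Y) \<otimes>\<^bsub>Q\<^esub> Z" and ?B = "Y \<otimes>\<^bsub>Q\<^esub> (X \<otimes>\<^bsub>Q\<^esub> Z)"
    let ?C = "Y \<otimes>\<^bsub>Q\<^esub> (Z \<otimes>\<^bsub>Q\<^esub> X)" and ?D = "Z \<otimes>\<^bsub>Q\<^esub> (X \<otimes>\<^bsub>Q\<^esub> Y)"
    note [simp] = 2 Q.prod_closed
    have BC: "?B \<oplus>\<^bsub>Q\<^esub> ?C = \<zero>\<^bsub>Q\<^esub>"
    proof -
      have "?B \<oplus>\<^bsub>Q\<^esub> ?C = Y \<otimes>\<^bsub>Q\<^esub> (X \<otimes>\<^bsub>Q\<^esub> Z \<oplus>\<^bsub>Q\<^esub> Z \<otimes>\<^bsub>Q\<^esub> X)"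
        by (simp add: Q.prod_add_right)
      also have "\<dots> = Y \<otimes>\<^bsub>Q\<^esub> \<zero>\<^bsub>Q\<^esub>"
        by (simp add: anti)
      also have "\<dots> = \<zero>\<^bsub>Q\<^esub>"
        using Q.prod_smult_right[of "\<zero>\<^bsub>K\<^esub>" Y Y] by simp
      finally show ?thesis .
    qed
    have "X \<otimes>\<^bsub>Q\<^esub> (Y \<otimes>\<^bsub>Q\<^esub> Z) \<oplus>\<^bsub>Q\<^esub> ?C \<oplus>\<^bsub>Q\<^esub> ?D = ?A \<oplus>\<^bsub>Q\<^esub> ?B \<oplus>\<^bsub>Q\<^esub> ?C \<oplus>\<^bsub>Q\<^esub> ?D"
      by (simp add: leib[of X Y Z])
    also have "\<dots> = (?A \<oplus>\<^bsub>Q\<^esub> ?D) \<oplus>\<^bsub>Q\<^esub> (?B \<oplus>\<^bsub>Q\<^esub> ?C)"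
      by (simp add: Q.M.a_ac)
    also have "\<dots> = \<zero>\<^bsub>Q\<^esub>"
      by (simp add: BC anti)
    finally show ?case .
  qed
qed

section \<open>Quotient algebras\<close>

lemma constant_UN_image: "x \<in> X \<Longrightarrow> (\<And>y. y \<in> X \<Longrightarrow> f y = f x) \<Longrightarrow> (\<Union>y\<in>X. f y) = f x"
  by blast

locale algebra_with_ideal = nonassoc_algebra K E + algebra_ideal M K E
  for K (structure) and E (structure) and M
begin

sublocale abelian_subgroup M E
  by (intro abelian_subgroupI3 additive_subgroup.intro M.abelian_group_axioms subgroup_axioms)

lemma coset_memE:
  assumes "y \<in> quotient_proj E M x" "x \<in> carrier E"
  obtains m where "m \<in> M" "m \<in> carrier E" "y = m \<oplus>\<^bsub>E\<^esub> x"
  using assms a_subset unfolding quotient_proj_def a_r_coset_def' by auto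

lemma proj_self: "x \<in> carrier E \<Longrightarrow> x \<in> quotient_proj E M x"
  unfolding quotient_proj_def by (rule a_rcos_self)

lemma proj_absorb: "m \<in> M \<Longrightarrow> x \<in> carrier E \<Longrightarrow> quotient_proj E M (m \<oplus>\<^bsub>E\<^esub> x) = quotient_proj E M x"
  unfolding quotient_proj_def
  by (intro a_repr_independence'[symmetric] M.a_rcosI a_subset)

lemma proj_zero: "m \<in> M \<Longrightarrow> quotient_proj E M m = M"
  unfolding quotient_proj_def by (rule a_rcos_const)

text \<open>
  The product of two cosets is a union over all representatives.  Changing the representatives of
  the factors changes the product by \<open>m \<cdot> v + x \<cdot> n\<close> with \<open>m\<close> and \<open>n\<close> in \<open>M\<close>, which is in \<open>M\<close> because
  the ideal is two-sided; so the union collapses to a single coset.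
\<close>

lemma proj_mult:
  assumes "x \<in> carrier E" "y \<in> carrier E"
  shows "rcoset_mult E M (quotient_proj E M x) (quotient_proj E M y) = quotient_proj E M (x \<otimes>\<^bsub>E\<^esub> y)"
proof -
  have *: "quotient_proj E M (u \<otimes>\<^bsub>E\<^esub> v) = quotient_proj E M (x \<otimes>\<^bsub>E\<^esub> y)"
    if u: "u \<in> quotient_proj E M x" and v: "v \<in> quotient_proj E M y" for u v
  proof -
    obtain m n where m: "m \<in> M" "m \<in> carrier E" "u = m \<oplus>\<^bsub>E\<^esub> x"
      and n: "n \<in> M" "n \<in> carrier E" "v = n \<oplus>\<^bsub>E\<^esub> y"
      using coset_memE[OF u assms(1)] coset_memE[OF v assms(2)] by metis
    have "u \<otimes>\<^bsub>E\<^esub> v = m \<otimes>\<^bsub>E\<^esub> v \<oplus>\<^bsub>E\<^esub> x \<otimes>\<^bsub>E\<^esub> v"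
      using m n assms by (simp add: prod_add_left)
    moreover have "x \<otimes>\<^bsub>E\<^esub> v = x \<otimes>\<^bsub>E\<^esub> n \<oplus>\<^bsub>E\<^esub> x \<otimes>\<^bsub>E\<^esub> y"
      using n assms by (simp add: prod_add_right)
    moreover have "v \<in> carrier E"
      using n assms by simp
    ultimately show ?thesis
      using m(1) n(1) assms by (simp add: proj_absorb ideal_left ideal_right prod_closed)
  qed
  then show ?thesis
    unfolding rcoset_mult_def quotient_proj_def[symmetric]
    using proj_self[OF assms(1)] proj_self[OF assms(2)] by blast
qed

lemma proj_smult:
  assumes "a \<in> carrier K" "x \<in> carrier E"
  shows "(\<Union>y\<in>quotient_proj E M x. quotient_proj E M (a \<odot>\<^bsub>E\<^esub> y)) = quotient_proj E M (a \<odot>\<^bsub>E\<^esub> x)"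
proof (rule constant_UN_image)
  show "x \<in> quotient_proj E M x"
    by (rule proj_self) fact
  fix y assume "y \<in> quotient_proj E M x"
  from this \<open>x \<in> carrier E\<close> obtain m where "m \<in> M" "m \<in> carrier E" "y = m \<oplus>\<^bsub>E\<^esub> x"
    by (rule coset_memE)
  then show "quotient_proj E M (a \<odot>\<^bsub>E\<^esub> y) = quotient_proj E M (a \<odot>\<^bsub>E\<^esub> x)"
    using assms by (simp add: smult_r_distr proj_absorb)
qed

sublocale proj: algebra_epimorphism K E "quotient_algebra E M" "quotient_proj E M"
proof unfold_locales
  have Q: "carrier (quotient_algebra E M) = a_rcosets\<^bsub>E\<^esub> M"
    "zero (quotient_algebra E M) = M"
    "add (quotient_algebra E M) = set_add E"
    "mult (quotient_algebra E M) = rcoset_mult E M"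
    "smult (quotient_algebra E M) = (\<lambda>a X. \<Union>x\<in>X. M +>\<^bsub>E\<^esub> (a \<odot>\<^bsub>E\<^esub> x))"
    by (simp_all add: quotient_algebra_def FactRing_def ring.defs module.defs)
  show surj: "carrier (quotient_algebra E M) = quotient_proj E M ` carrier E"
    by (auto simp: Q A_RCOSETS_def' quotient_proj_def)
  show "\<zero>\<^bsub>quotient_algebra E M\<^esub> = quotient_proj E M \<zero>\<^bsub>E\<^esub>"
    by (simp add: Q proj_zero)
  have "quotient_proj E M (x \<oplus>\<^bsub>E\<^esub> y) = quotient_proj E M x <+>\<^bsub>E\<^esub> quotient_proj E M y"
    if "x \<in> carrier E" "y \<in> carrier E" for x y
    using that by (simp add: quotient_proj_def a_rcos_sum)
  then show "quotient_proj E M \<in> algebra_homs K E (quotient_algebra E M)"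
    by (simp add: algebra_homs_def linear_maps_def surj Q quotient_proj_def[symmetric]
        proj_mult proj_smult)
qed

end

section \<open>Semidirect products\<close>

locale Lie_representation = H: Lie_algebra K H + V: module K V
  for K (structure) and H (structure) and V (structure) +
  fixes \<rho>
  assumes act_closed: "\<lbrakk>\<xi> \<in> carrier H; x \<in> carrier V\<rbrakk> \<Longrightarrow> \<rho> \<xi> x \<in> carrier V"
    and act_add_right: "\<lbrakk>\<xi> \<in> carrier H; x \<in> carrier V; y \<in> carrier V\<rbrakk>
      \<Longrightarrow> \<rho> \<xi> (x \<oplus>\<^bsub>V\<^esub> y) = \<rho> \<xi> x \<oplus>\<^bsub>V\<^esub> \<rho> \<xi> y"
    and act_smult_right: "\<lbrakk>\<xi> \<in> carrier H; a \<in> carrier K; x \<in> carrier V\<rbrakk>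
      \<Longrightarrow> \<rho> \<xi> (a \<odot>\<^bsub>V\<^esub> x) = a \<odot>\<^bsub>V\<^esub> \<rho> \<xi> x"
    and act_add_left: "\<lbrakk>\<xi> \<in> carrier H; \<eta> \<in> carrier H; x \<in> carrier V\<rbrakk>
      \<Longrightarrow> \<rho> (\<xi> \<oplus>\<^bsub>H\<^esub> \<eta>) x = \<rho> \<xi> x \<oplus>\<^bsub>V\<^esub> \<rho> \<eta> x"
    and act_smult_left: "\<lbrakk>a \<in> carrier K; \<xi> \<in> carrier H; x \<in> carrier V\<rbrakk>
      \<Longrightarrow> \<rho> (a \<odot>\<^bsub>H\<^esub> \<xi>) x = a \<odot>\<^bsub>V\<^esub> \<rho> \<xi> x"
    and act_bracket: "\<lbrakk>\<xi> \<in> carrier H; \<eta> \<in> carrier H; x \<in> carrier V\<rbrakk>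
      \<Longrightarrow> \<rho> (\<xi> \<otimes>\<^bsub>H\<^esub> \<eta>) x = \<rho> \<xi> (\<rho> \<eta> x) \<ominus>\<^bsub>V\<^esub> \<rho> \<eta> (\<rho> \<xi> x)"

text \<open>
  With \<open>a, b, c, d, e, f\<close> standing for \<open>\<xi>\<eta>z, \<xi>\<zeta>y, \<eta>\<zeta>x, \<zeta>\<eta>x, \<eta>\<xi>z, \<zeta>\<xi>y\<close>, the left-hand side is the
  second component of the Jacobi sum of \<open>(\<xi>, x)\<close>, \<open>(\<eta>, y)\<close> and \<open>(\<zeta>, z)\<close> in a semidirect product.
\<close>

lemma (in abelian_group) cyclic_commutator_sum:
  assumes "a \<in> carrier G" "b \<in> carrier G" "c \<in> carrier G"
    "d \<in> carrier G" "e \<in> carrier G" "f \<in> carrier G"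
  shows "((a \<ominus> b) \<ominus> (c \<ominus> d)) \<oplus> ((c \<ominus> e) \<ominus> (f \<ominus> b)) \<oplus> ((f \<ominus> d) \<ominus> (a \<ominus> e)) = \<zero>"
proof -
  have "((a \<ominus> b) \<ominus> (c \<ominus> d)) \<oplus> ((c \<ominus> e) \<ominus> (f \<ominus> b)) \<oplus> ((f \<ominus> d) \<ominus> (a \<ominus> e))
    = (a \<ominus> a) \<oplus> (b \<ominus> b) \<oplus> (c \<ominus> c) \<oplus> (d \<ominus> d) \<oplus> (e \<ominus> e) \<oplus> (f \<ominus> f)"
    using assms by (simp add: minus_eq minus_add a_ac)
  then show ?thesis
    using assms by (simp add: minus_eq r_neg)
qed

lemma (in Lie_representation) act_diff:
  assumes "\<xi> \<in> carrier H" "x \<in> carrier V" "y \<in> carrier V"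
  shows "\<rho> \<xi> (x \<ominus>\<^bsub>V\<^esub> y) = \<rho> \<xi> x \<ominus>\<^bsub>V\<^esub> \<rho> \<xi> y"
proof -
  have "\<rho> \<xi> (x \<ominus>\<^bsub>V\<^esub> y) \<oplus>\<^bsub>V\<^esub> \<rho> \<xi> y = \<rho> \<xi> x"
    using assms by (simp add: act_add_right[symmetric] V.M.minus_eq V.M.a_assoc V.M.l_neg)
  then show ?thesis
    using assms act_closed[of \<xi>] V.M.minus_closed[of x y]
    by (metis V.M.add.inv_solve_right' V.M.minus_eq)
qed

text \<open>
  Expanding the action of a bracket as a commutator turns the second component of the Jacobi sum
  into twelve terms that cancel in pairs; the first component is the Jacobi identity of \<open>H\<close>.
\<close>

theorem (in Lie_representation) semidirect_product_Lie_algebra: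
  "Lie_algebra K (semidirect_product H \<rho> V)"
proof -
  let ?G = "semidirect_product H \<rho> V"
  note closed [simp] = act_closed H.prod_closed
  have ag: "abelian_group ?G"
  proof (rule abelian_groupI)
    fix u assume "u \<in> carrier ?G"
    then show "\<exists>v\<in>carrier ?G. v \<oplus>\<^bsub>?G\<^esub> u = \<zero>\<^bsub>?G\<^esub>"
      by (intro bexI[of _ "(\<ominus>\<^bsub>H\<^esub> fst u, \<ominus>\<^bsub>V\<^esub> snd u)"])
        (auto simp: semidirect_product_def H.E.M.l_neg V.M.l_neg)
  qed (auto simp: semidirect_product_def H.E.M.a_ac V.M.a_ac)
  interpret G: module K ?G
    by (rule moduleI[OF H.K.is_cring ag])
      (auto simp: semidirect_product_def H.smult_l_distr H.smult_r_distr H.smult_assoc1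
        V.smult_l_distr V.smult_r_distr V.smult_assoc1)
  have smult_diff: "a \<odot>\<^bsub>V\<^esub> (x \<ominus>\<^bsub>V\<^esub> y) = a \<odot>\<^bsub>V\<^esub> x \<ominus>\<^bsub>V\<^esub> a \<odot>\<^bsub>V\<^esub> y"
    if "a \<in> carrier K" "x \<in> carrier V" "y \<in> carrier V" for a x y
    using that by (simp add: V.M.minus_eq V.smult_r_distr V.smult_r_minus)
  interpret G: nonassoc_algebra K ?G
  proof (unfold_locales, goal_cases)
    case (1 u v)
    then show ?case by (auto simp: semidirect_product_def)
  next
    case (2 u v w)
    then show ?case
      by (auto simp: semidirect_product_def act_add_left act_add_right H.prod_add_left
          V.M.minus_eq V.M.minus_add V.M.a_ac)
  next
    case (3 u v w)
    then show ?case
      by (auto simp: semidirect_product_def act_add_left act_add_right H.prod_add_right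
          V.M.minus_eq V.M.minus_add V.M.a_ac)
  next
    case (4 a u v)
    then show ?case
      by (auto simp: semidirect_product_def act_smult_left act_smult_right H.prod_smult_left smult_diff)
  next
    case (5 a u v)
    then show ?case
      by (auto simp: semidirect_product_def act_smult_left act_smult_right H.prod_smult_right smult_diff)
  qed
  show ?thesis
  proof (unfold_locales, goal_cases)
    case (1 u)
    then show ?case
      by (auto simp: semidirect_product_def H.bracket_self V.M.minus_eq V.M.r_neg)
  next
    case (2 u v w)
    obtain \<xi> x \<eta> y \<zeta> z where uvw: "u = (\<xi>, x)" "v = (\<eta>, y)" "w = (\<zeta>, z)"
      by (metis surj_pair)
    with 2 have c: "\<xi> \<in> carrier H" "\<eta> \<in> carrier H" "\<zeta> \<in> carrier H"
      "x \<in> carrier V" "y \<in> carrier V" "z \<in> carrier V"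
      by (auto simp: semidirect_product_def)
    then show ?case
      unfolding uvw
      by (simp add: semidirect_product_def H.jacobi act_bracket act_diff V.M.cyclic_commutator_sum)
  qed
qed

text \<open>
  The bracket on \<^term>\<open>Der K E\<close> is the commutator of maps, so a derivation action is in particular a
  representation on the underlying vector space.
\<close>

lemma Lie_representationI_Der:
  fixes K (structure) and H (structure) and E (structure)
  assumes "Lie_algebra K H" "module K E" and hom: "\<rho> \<in> algebra_homs K H (Der K E)"
  shows "Lie_representation K H E \<rho>"
proof -
  interpret H: Lie_algebra K H by fact
  interpret E: module K E by fact
  have der: "\<rho> \<xi> \<in> derivations K E" if "\<xi> \<in> carrier H" for \<xi>
    using hom that by (auto simp: algebra_homs_def linear_maps_def Der_def)
  then have lin: "\<rho> \<xi> \<in> linear_maps K E E" if "\<xi> \<in> carrier H" for \<xi>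
    using that by (simp add: derivations_def)
  show ?thesis
  proof (unfold_locales, goal_cases)
    case (1 \<xi> x)
    then show ?case using lin[of \<xi>] by (auto simp: linear_maps_def)
  next
    case (2 \<xi> x y)
    then show ?case using lin[of \<xi>] by (simp add: linear_maps_def)
  next
    case (3 \<xi> a x)
    then show ?case using lin[of \<xi>] by (simp add: linear_maps_def)
  next
    case (4 \<xi> \<eta> x)
    then have "\<rho> (\<xi> \<oplus>\<^bsub>H\<^esub> \<eta>) = \<rho> \<xi> \<oplus>\<^bsub>Der K E\<^esub> \<rho> \<eta>"
      using hom by (simp add: algebra_homs_def linear_maps_def)
    with 4 show ?case by (simp add: Der_def)
  next
    case (5 a \<xi> x)
    then have "\<rho> (a \<odot>\<^bsub>H\<^esub> \<xi>) = a \<odot>\<^bsub>Der K E\<^esub> \<rho> \<xi>"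
      using hom by (simp add: algebra_homs_def linear_maps_def)
    with 5 show ?case by (simp add: Der_def)
  next
    case (6 \<xi> \<eta> x)
    then have "\<rho> (\<xi> \<otimes>\<^bsub>H\<^esub> \<eta>) = \<rho> \<xi> \<otimes>\<^bsub>Der K E\<^esub> \<rho> \<eta>"
      using hom by (simp add: algebra_homs_def)
    with 6 show ?case by (simp add: Der_def)
  qed
qed

section \<open>The action induced by left multiplication\<close>

context Leibniz_algebra
begin

lemma left_mult_derivation:
  assumes "x \<in> carrier E"
  shows "left_mult E x \<in> derivations K E"
proof -
  have "left_mult E x (y \<otimes>\<^bsub>E\<^esub> z) = left_mult E x y \<otimes>\<^bsub>E\<^esub> z \<oplus>\<^bsub>E\<^esub> y \<otimes>\<^bsub>E\<^esub> left_mult E x z"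
    if "y \<in> carrier E" "z \<in> carrier E" for y z
    using that assms by (simp add: left_mult_def prod_closed leibniz[of x y z])
  moreover have "left_mult E x \<in> linear_maps K E E"
    using assms by (auto simp: linear_maps_def left_mult_def prod_closed prod_add_right prod_smult_right)
  moreover have "left_mult E x \<in> extensional (carrier E)"
    by (simp add: left_mult_def)
  ultimately show ?thesis
    by (simp add: derivations_def)
qed

text \<open>
  Solved for \<open>(x \<cdot> y) \<cdot> z\<close>, the Leibniz identity says that \<open>\<lambda>\<close> maps products to commutators.
\<close>

lemma left_mult_hom: "left_mult E \<in> algebra_homs K E (Der K E)"
proof -
  have "(x \<otimes>\<^bsub>E\<^esub> y) \<otimes>\<^bsub>E\<^esub> z = x \<otimes>\<^bsub>E\<^esub> (y \<otimes>\<^bsub>E\<^esub> z) \<ominus>\<^bsub>E\<^esub> y \<otimes>\<^bsub>E\<^esub> (x \<otimes>\<^bsub>E\<^esub> z)"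
    if "x \<in> carrier E" "y \<in> carrier E" "z \<in> carrier E" for x y z
    using that by (subst leibniz) (simp_all add: M.minus_eq M.a_assoc M.r_neg prod_closed)
  then show ?thesis
    by (auto simp: algebra_homs_def linear_maps_def Der_def left_mult_derivation)
      (auto simp: left_mult_def prod_closed prod_add_left prod_smult_left fun_eq_iff)
qed

end

text \<open>
  Left multiplication is additive and vanishes on \<open>M\<close>, hence is constant on each coset, which makes
  its image of a coset a singleton.
\<close>

lemma (in algebra_with_ideal) induced_action_proj:
  assumes ker: "M \<subseteq> a_kernel E (Der K E) (left_mult E)" and x: "x \<in> carrier E"
  shows "induced_action E (quotient_proj E M x) = left_mult E x"
proof -
  have "left_mult E y = left_mult E x" if y: "y \<in> quotient_proj E M x" for y
  proof -
    obtain m where m: "m \<in> M" "m \<in> carrier E" "y = m \<oplus>\<^bsub>E\<^esub> x"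
      by (rule coset_memE[OF y x])
    have "left_mult E m = (\<lambda>z\<in>carrier E. \<zero>\<^bsub>E\<^esub>)"
      using m ker by (auto simp: a_kernel_def kernel_def Der_def)
    then have "m \<otimes>\<^bsub>E\<^esub> z = \<zero>\<^bsub>E\<^esub>" if "z \<in> carrier E" for z
      using that by (metis left_mult_def restrict_apply')
    then show ?thesis
      using m x by (auto simp: left_mult_def fun_eq_iff prod_add_left prod_closed)
  qed
  then have "left_mult E ` quotient_proj E M x = {left_mult E x}"
    using proj_self[OF x] by blast
  then show ?thesis
    by (simp add: induced_action_def)
qed

theorem theorem2p6:
  fixes K :: "('k, 'n) ring_scheme" and E :: "('k, 'e, 'a) module_scheme" and M :: "'e set"
  assumes "char_0_field K"
    and "Leibniz_algebra K E"
    and "algebra_ideal M K E"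
    and "squares_ideal K E \<subseteq> M"
    and "M \<subseteq> a_kernel E (Der K E) (left_mult E)"
  shows "enveloping_Lie_algebra K E (induced_action E)
    (semidirect_product (quotient_algebra E M) (induced_action E) E)
    (quotient_algebra E M)
    (quotient_proj E M)"
proof -
  interpret E: Leibniz_algebra K E by fact
  interpret algebra_ideal M K E by fact
  interpret I: algebra_with_ideal K E M by unfold_locales
  let ?H = "quotient_algebra E M" and ?q = "quotient_proj E M" and ?\<rho> = "induced_action E"
  note act = I.induced_action_proj[OF assms(5)]
  have "x \<otimes>\<^bsub>E\<^esub> x \<in> M" if "x \<in> carrier E" for x
    using that assms(4) by (auto simp: squares_ideal_def)
  then have "?q (x \<otimes>\<^bsub>E\<^esub> x) = \<zero>\<^bsub>?H\<^esub>" if "x \<in> carrier E" for x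
    using that by (simp add: I.proj.zero I.proj_zero)
  then have H: "Lie_algebra K ?H"
    by (rule Leibniz_image_Lie_algebra[OF assms(2) I.proj.algebra_epimorphism_axioms])
  have hom: "?\<rho> \<in> algebra_homs K ?H (Der K E)"
    using E.left_mult_hom
    by (auto simp: algebra_homs_def linear_maps_def I.proj.surj I.proj.map_simps act E.prod_closed)
  have G: "Lie_algebra K (semidirect_product ?H ?\<rho> E)"
    by (intro Lie_representation.semidirect_product_Lie_algebra Lie_representationI_Der
        H hom E.module_axioms)
  show ?thesis
  proof (intro enveloping_Lie_algebra.intro enveloping_Lie_algebra_axioms.intro H G hom assms(2) refl)
    show "?q \<in> linear_maps K E ?H"
      using I.proj.hom by (simp add: algebra_homs_def)
    show "\<xi> \<otimes>\<^bsub>?H\<^esub> ?q x = ?q (?\<rho> \<xi> x)" if "\<xi> \<in> carrier ?H" "x \<in> carrier E" for \<xi> x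
      using that by (auto simp: I.proj.surj I.proj.map_simps act left_mult_def)
    show "?\<rho> (?q x) y = x \<otimes>\<^bsub>E\<^esub> y" if "x \<in> carrier E" "y \<in> carrier E" for x y
      using that by (simp add: act left_mult_def)
  qed
qed

end
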